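(* Let $\Gamma$ be a context and $t$ an infinitary lambda tree of type $\rho$ whose free variables lie in $\mathrm{dom}(\Gamma)$ with the types assigned there. Then for every $n\in\mathbb N$, $\vdash^n_\Gamma \llbracket t\rrbracket^\Gamma_\infty : t : \rho$.
   Context: Setting: $\Sigma'$ ranked alphabet, $\Sigma=\Sigma'\cup\{\mathcal R,\beta\}$ with $\mathcal R,\beta$ unary; $\mathfrak A$ a fixed trivial automaton over $\Sigma$ (maximal arity $N$) with finite state set $Q$ and $\delta\colon Q\times\Sigma\to\mathcal P((Q\cup\{\ast\})^N)$, $\delta(q,\mathfrak f)\subseteq Q^{\mathrm{ar}(\mathfrak f)}\times\{\ast\}^{N-\mathrm{ar}(\mathfrak f)}$. A run starting in $q$ on a $\Sigma$-term is a labelling $r$ of nodes by states with root labelled $q$ and $(r(p_1),\dots,r(p_{\mathrm{ar}(\mathfrak f)}),\ast,\dots,\ast)\in\delta(r(p),\mathfrak f)$ for each $\mathfrak f$-node $p$ with children $p_i$. Lambda trees: possibly infinite simply-typed trees built from variables, $\lambda x^\rho$, application and constants $\mathfrak f\in\Sigma'$ of type $\iota^{\mathrm{ar}(\mathfrak f)}\to\iota$. Continuous normal form: for closed $t,\vec t$ with $t\vec t:\iota$, $\mathrm{cn}(rs;\vec t)=\mathcal R(\mathrm{cn}(r;s,\vec t))$, $\mathrm{cn}(\lambda x.r;s,\vec t)=\beta(\mathrm{cn}(r[s/x];\vec t))$, $\mathrm{cn}(\mathfrak f;\vec t)=\mathfrak f(t_1^\beta,\dots,t_n^\beta)$, $t^\beta=\mathrm{cn}(t;())$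 (coinductively). Semantics: $\llbracket\iota\rrbracket=\mathcal P(Q)$, $\llbracket\rho\to\sigma\rrbracket$ = all functions $\llbracket\rho\rrbracket\to\llbracket\sigma\rrbracket$; order $\sqsubseteq$: inclusion on $\mathcal P(Q)$, pointwise on functions. For $f\in\llbracket\vec\rho\to\iota\rrbracket$, $\mathcal R(f)(\vec a)=\{q\mid \delta(q,\mathcal R)\cap (f\vec a\times\{\ast\}^{N-1})\ne\emptyset\}$ and $\beta(f)$ likewise with $\delta(q,\beta)$. A context $\Gamma$ is a finite map from variables $x^\sigma$ to $\llbracket\sigma\rrbracket$; $\Gamma^a_x$ is $\Gamma$ updated with $x\mapsto a$. Proof system $\vdash^n_\Gamma a:t:\rho$ (for $a\in\llbracket\rho\rrbracket$, $t:\rho$ with free variables in $\mathrm{dom}\Gamma$), by induction on $n$: (i) $\vdash^0_\Gamma a:t:\rho$ always; (ii) $\vdash^n_\Gamma a:x:\rho$ if $a\sqsubseteq\Gamma(x)$; (iii) $\vdash^{n+1}_\Gamma a:st:\sigma$ if there are $f\in\llbracket\rho\to\sigma\rrbracket$, $u\in\llbracket\rho\rrbracket$ with $a\sqsubseteq\mathcal R(fu)$, $\vdash^n_\Gamma f:s:\rho\to\sigma$ and $\vdash^n_\Gamma u:t:\rho$; (iv) $\vdash^{n+1}_\Gamma f:\lambda x^\rho.s:\rho\to\sigma$ if for every $a\in\llbracket\rho\rrbracket$ there is $b_a\in\llbracket\sigma\rrbracket$ with $fa\sqsubseteq\beta(b_a)$ and $\vdash^n_{\Gamma^a_x} b_a:s:\sigma$;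 (v) $\vdash^n_\Gamma f:\mathfrak f:\iota\to\dots\to\iota$ if for all $a_1,\dots,a_{\mathrm{ar}(\mathfrak f)}\in\mathcal P(Q)$, $f\vec a\subseteq\{q\mid\delta(q,\mathfrak f)\cap (a_1\times\dots\times a_{\mathrm{ar}(\mathfrak f)}\times\{\ast\}^{N-\mathrm{ar}(\mathfrak f)})\neq\emptyset\}$. Canonical semantics: for closed $t$ of type $\vec\rho\to\iota$, by induction on the type, $\llbracket t\rrbracket_\infty(\vec a)=\{q\mid \exists$ closed $\vec s:\vec\rho$ with $\llbracket s_i\rrbracket_\infty\sqsubseteq a_i$ for all $i$ and $\mathfrak A$ has a run on $\mathrm{cn}(t;\vec s)$ starting in $q\}$. For $t$ typed in context $\Gamma$ of type $\vec\rho\to\iota$: $\llbracket t\rrbracket^\Gamma_\infty(\vec a)=\{q\mid\exists$ substitution $\eta$ with $\mathrm{dom}\,\eta=\mathrm{dom}\,\Gamma$, each $\eta(x)$ closed with $\llbracket\eta(x)\rrbracket_\infty\sqsubseteq\Gamma(x)$, and $\exists$ closed $\vec s:\vec\rho$ with $\llbracket s_i\rrbracket_\infty\sqsubseteq a_i$, such that $\mathfrak A$ has a run on $\mathrm{cn}(t\eta;\vec s)$ starting in $q\}$. *)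

theory Defs
  imports "HOL-Library.FSet"
begin

datatype ty = Iota | Arr ty ty  (infixr "\<leadsto>" 60)

primrec args :: "ty \<Rightarrow> ty list" where
  "args Iota = []"
| "args (\<rho> \<leadsto> \<sigma>) = \<rho> # args \<sigma>"

text \<open>A variable \<open>x\<^sup>\<rho>\<close> is a name together with its type, so \<open>snd x\<close> is the type of \<open>x\<close>.\<close>

type_synonym 'v var = "'v \<times> ty"

text \<open>
  Every node of a lambda tree belongs to a type. For an application this type is recorded in the
  node: otherwise a tree with an infinite left spine of applications would have several types.
  Binders are named. Only closed trees are ever substituted, so no capture can occur and
  no renaming of bound variables is needed.
\<close>

codatatype ('v, 'f) lam =
    Var "'v var"
  | Lam "'v var" "('v, 'f) lam"
  | App ty "('v, 'f) lam" "('v, 'f) lam"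
  | Const 'f

primrec const_type :: "nat \<Rightarrow> ty" where
  "const_type 0 = Iota"
| "const_type (Suc n) = Iota \<leadsto> const_type n"

coinductive has_type :: "('f \<Rightarrow> nat) \<Rightarrow> ('v, 'f) lam \<Rightarrow> ty \<Rightarrow> bool" for ar where
  "has_type ar (Var x) (snd x)"
| "has_type ar s \<sigma> \<Longrightarrow> has_type ar (Lam x s) (snd x \<leadsto> \<sigma>)"
| "has_type ar s (\<rho> \<leadsto> \<sigma>) \<Longrightarrow> has_type ar t \<rho> \<Longrightarrow> has_type ar (App \<sigma> s t) \<sigma>"
| "has_type ar (Const f) (const_type (ar f))"

inductive free_in :: "'v var \<Rightarrow> ('v, 'f) lam \<Rightarrow> bool" for x where
  "free_in x (Var x)"
| "free_in x s \<Longrightarrow> x \<noteq> y \<Longrightarrow> free_in x (Lam y s)"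
| "free_in x s \<Longrightarrow> free_in x (App \<sigma> s t)"
| "free_in x t \<Longrightarrow> free_in x (App \<sigma> s t)"

definition fv :: "('v, 'f) lam \<Rightarrow> 'v var set" where
  "fv t = {x. free_in x t}"

definition closed_of_type :: "('f \<Rightarrow> nat) \<Rightarrow> ('v, 'f) lam \<Rightarrow> ty \<Rightarrow> bool" where
  "closed_of_type ar t \<rho> \<longleftrightarrow> fv t = {} \<and> has_type ar t \<rho>"

primcorec subst :: "('v var \<rightharpoonup> ('v, 'f) lam) \<Rightarrow> ('v, 'f) lam \<Rightarrow> ('v, 'f) lam" where
  "subst \<eta> t = (case t of
      Var x \<Rightarrow> (case \<eta> x of None \<Rightarrow> Var x | Some s \<Rightarrow> s)
    | Lam x s \<Rightarrow> Lam x (subst (\<eta>(x := None)) s)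
    | App \<sigma> r s \<Rightarrow> App \<sigma> (subst \<eta> r) (subst \<eta> s)
    | Const f \<Rightarrow> Const f)"

lemma has_type_unique: "has_type ar t \<rho> \<Longrightarrow> has_type ar t \<sigma> \<Longrightarrow> \<rho> = \<sigma>"
proof (induction \<rho> arbitrary: t \<sigma>)
  case Iota
  then show ?case by (auto elim: has_type.cases)
next
  case (Arr \<rho>1 \<rho>2)
  show ?case
  proof (cases "\<exists>x s. t = Lam x s")
    case True
    then obtain x s where t: "t = Lam x s" by blast
    from Arr.prems(1) have 1: "\<rho>1 = snd x" "has_type ar s \<rho>2"
      unfolding t by (auto elim: has_type.cases)
    from Arr.prems(2) obtain \<tau> where 2: "\<sigma> = snd x \<leadsto> \<tau>" "has_type ar s \<tau>"
      unfolding t by (auto elim: has_type.cases)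
    from Arr.IH(2)[OF 1(2) 2(2)] 1 2 show ?thesis by simp
  next
    case False
    from Arr.prems(1) show ?thesis
      using Arr.prems(2) False by (cases rule: has_type.cases) (auto elim: has_type.cases)
  qed
qed

datatype 'f letter = Orig 'f | Rep | Beta

codatatype 'f tree = Node (root: "'f letter") (children: "'f tree list")

text \<open>
  \<open>cn t ts\<close> is meant for closed \<open>t\<close>, \<open>ts\<close> such that \<open>t\<close> applied to \<open>ts\<close> has type \<open>Iota\<close>; the
  cases of a variable and of an abstraction without arguments do not arise then, and their values
  are irrelevant. See \<open>cn_simps\<close> for the defining equations in their usual form.
\<close>

primcorec cn :: "('v, 'f) lam \<Rightarrow> ('v, 'f) lam list \<Rightarrow> 'f tree" where
  "cn t ts = (case t of
      App \<sigma> r s \<Rightarrow> Node Rep (map (\<lambda>(u, us). cn u us) [(r, s # ts)])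
    | Lam x r \<Rightarrow> Node Beta (map (\<lambda>(u, us). cn u us)
        (case ts of [] \<Rightarrow> [] | s # ss \<Rightarrow> [(subst [x \<mapsto> s] r, ss)]))
    | Const f \<Rightarrow> Node (Orig f) (map (\<lambda>(u, us). cn u us) (map (\<lambda>u. (u, [])) ts))
    | Var x \<Rightarrow> Node Beta [])"

lemma cn_simps:
  "cn (App \<sigma> r s) ts = Node Rep [cn r (s # ts)]"
  "cn (Lam x r) (s # ts) = Node Beta [cn (subst [x \<mapsto> s] r) ts]"
  "cn (Const f) ts = Node (Orig f) (map (\<lambda>u. cn u []) ts)"
  by (subst cn.code; simp)+

text \<open>
  An element of \<open>(Q \<union> {*})\<^sup>N\<close> is a list of length \<open>N\<close> over \<^typ>\<open>'q option\<close>, with \<^term>\<open>None\<close>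
  in the role of \<open>*\<close>. The arities of the letters of \<open>\<Sigma>'\<close> are kept with the automaton.
\<close>

record ('f, 'q) automaton =
  arity :: "'f \<Rightarrow> nat"
  width :: nat
  delta :: "'q \<Rightarrow> 'f letter \<Rightarrow> 'q option list set"

primrec letter_arity :: "('f \<Rightarrow> nat) \<Rightarrow> 'f letter \<Rightarrow> nat" where
  "letter_arity ar (Orig f) = ar f"
| "letter_arity ar Rep = 1"
| "letter_arity ar Beta = 1"

text \<open>\<open>padded N [A\<^sub>1, \<dots>, A\<^sub>k]\<close> is \<open>A\<^sub>1 \<times> \<dots> \<times> A\<^sub>k \<times> {*}\<^sup>N\<^sup>-\<^sup>k\<close>.\<close>

definition padded :: "nat \<Rightarrow> 'q set list \<Rightarrow> 'q option list set" where
  "padded N As = {map Some qs @ replicate (N - length As) None | qs. list_all2 (\<in>) qs As}"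

definition trivial_automaton :: "('f, 'q) automaton \<Rightarrow> bool" where
  "trivial_automaton \<AA> \<longleftrightarrow>
     (\<forall>l. letter_arity (arity \<AA>) l \<le> width \<AA>) \<and>
     (\<exists>l. letter_arity (arity \<AA>) l = width \<AA>) \<and>
     (\<forall>q l. delta \<AA> q l \<subseteq> padded (width \<AA>) (replicate (letter_arity (arity \<AA>) l) UNIV))"

primrec subtree_at :: "nat list \<Rightarrow> 'f tree \<Rightarrow> 'f tree option" where
  "subtree_at [] T = Some T"
| "subtree_at (i # p) T =
     (if i < length (children T) then subtree_at p (children T ! i) else None)"

text \<open>
  Nodes are addressed by paths from the root; the values of \<open>r\<close> on paths that are not nodes of
  \<open>T\<close> play no role.
\<close>

definition is_run :: "('f, 'q) automaton \<Rightarrow> 'q \<Rightarrow> 'f tree \<Rightarrow> (nat list \<Rightarrow> 'q) \<Rightarrow> bool" where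
  "is_run \<AA> q T r \<longleftrightarrow> r [] = q \<and>
     (\<forall>p U. subtree_at p T = Some U \<longrightarrow>
        (let k = letter_arity (arity \<AA>) (root U) in
          map (\<lambda>i. Some (r (p @ [i]))) [0..<k] @ replicate (width \<AA> - k) None
            \<in> delta \<AA> (r p) (root U)))"

definition has_run :: "('f, 'q) automaton \<Rightarrow> 'q \<Rightarrow> 'f tree \<Rightarrow> bool" where
  "has_run \<AA> q T \<longleftrightarrow> (\<exists>r. is_run \<AA> q T r)"

text \<open>
  The sets \<open>\<lbrakk>\<rho>\<rbrakk>\<close> for all types \<open>\<rho>\<close> live in one type. A function is represented by its graph,
  which is a finite set because \<open>Q\<close> is finite.
\<close>

datatype 'q val = Base "'q set" | Graph "('q val \<times> 'q val) fset"

primrec den :: "ty \<Rightarrow> 'q val set" where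
  "den Iota = range Base"
| "den (\<rho> \<leadsto> \<sigma>) =
     {Graph g | g. fset g \<subseteq> den \<rho> \<times> den \<sigma> \<and> (\<forall>a\<in>den \<rho>. \<exists>!b. (a, b) |\<in>| g)}"

primrec base :: "'q val \<Rightarrow> 'q set" where
  "base (Base A) = A"
| "base (Graph g) = {}"

primrec app :: "'q val \<Rightarrow> 'q val \<Rightarrow> 'q val" where
  "app (Base A) = (\<lambda>a. Base A)"
| "app (Graph g) = (\<lambda>a. THE b. (a, b) |\<in>| g)"

definition apps :: "'q val \<Rightarrow> 'q val list \<Rightarrow> 'q val" where
  "apps f as = foldl app f as"

primrec below :: "ty \<Rightarrow> 'q val \<Rightarrow> 'q val \<Rightarrow> bool" where
  "below Iota = (\<lambda>a b. base a \<subseteq> base b)"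
| "below (\<rho> \<leadsto> \<sigma>) = (\<lambda>f g. \<forall>a\<in>den \<rho>. below \<sigma> (app f a) (app g a))"

definition abstr :: "ty \<Rightarrow> ('q val \<Rightarrow> 'q val) \<Rightarrow> 'q val" where
  "abstr \<rho> F = Graph (Abs_fset ((\<lambda>a. (a, F a)) ` den \<rho>))"

text \<open>
  \<open>curried \<tau> F\<close>, where \<open>\<tau>\<close> is \<open>\<rho>\<^sub>1 \<leadsto> \<dots> \<leadsto> \<rho>\<^sub>n \<leadsto> Iota\<close>, is the element of \<open>\<lbrakk>\<tau>\<rbrakk>\<close> that maps
  \<open>a\<^sub>1, \<dots>, a\<^sub>n\<close> to \<open>F [a\<^sub>1, \<dots>, a\<^sub>n]\<close>.
\<close>

primrec curried :: "ty \<Rightarrow> ('q val list \<Rightarrow> 'q set) \<Rightarrow> 'q val" where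
  "curried Iota = (\<lambda>F. Base (F []))"
| "curried (\<rho> \<leadsto> \<sigma>) = (\<lambda>F. abstr \<rho> (\<lambda>a. curried \<sigma> (\<lambda>as. F (a # as))))"

lemma finite_den: "finite (den \<rho> :: 'q::finite val set)"
proof (induction \<rho>)
  case Iota
  then show ?case by simp
next
  case (Arr \<rho> \<sigma>)
  let ?S = "den \<rho> \<times> den \<sigma> :: ('q val \<times> 'q val) set"
  have "den (\<rho> \<leadsto> \<sigma>) \<subseteq> (\<lambda>X. Graph (Abs_fset X)) ` Pow ?S"
  proof
    fix f :: "'q val" assume "f \<in> den (\<rho> \<leadsto> \<sigma>)"
    then obtain g where "f = Graph g" "fset g \<subseteq> ?S" by auto
    then show "f \<in> (\<lambda>X. Graph (Abs_fset X)) ` Pow ?S"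
      by (intro image_eqI[where x = "fset g"]) (auto simp: fset_inverse)
  qed
  moreover have "finite ((\<lambda>X. Graph (Abs_fset X)) ` Pow ?S)"
    using Arr.IH by simp
  ultimately show ?case by (rule finite_subset)
qed

lemma fset_abstr:
  "fset (Abs_fset ((\<lambda>a. (a, F a)) ` den \<rho>)) = (\<lambda>a. (a, F a)) ` (den \<rho> :: 'q::finite val set)"
  by (rule Abs_fset_inverse) (simp add: finite_den)

lemma app_abstr:
  fixes a :: "'q::finite val"
  shows "a \<in> den \<rho> \<Longrightarrow> app (abstr \<rho> F) a = F a"
  by (auto simp: abstr_def fset_abstr)

lemma abstr_in_den:
  fixes F :: "'q::finite val \<Rightarrow> 'q val"
  shows "(\<And>a. a \<in> den \<rho> \<Longrightarrow> F a \<in> den \<sigma>) \<Longrightarrow> abstr \<rho> F \<in> den (\<rho> \<leadsto> \<sigma>)"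
  by (auto simp: abstr_def fset_abstr)

lemma app_in_den:
  assumes "f \<in> den (\<rho> \<leadsto> \<sigma>)" "a \<in> den \<rho>"
  shows "app f a \<in> den \<sigma>"
proof -
  obtain g where g: "f = Graph g" "fset g \<subseteq> den \<rho> \<times> den \<sigma>" "\<exists>!b. (a, b) |\<in>| g"
    using assms by auto
  from theI'[OF g(3)] g(1,2) show ?thesis by auto
qed

lemma curried_in_den: "curried \<tau> F \<in> (den \<tau> :: 'q::finite val set)"
proof (induction \<tau> arbitrary: F)
  case Iota
  show ?case by simp
next
  case (Arr \<rho> \<sigma>)
  show ?case unfolding curried.simps by (rule abstr_in_den) (rule Arr.IH(2))
qed

lemma apps_curried:
  fixes as :: "'q::finite val list"
  shows "list_all2 (\<lambda>a \<rho>. a \<in> den \<rho>) as (args \<tau>) \<Longrightarrow> base (apps (curried \<tau> F) as) = F as"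
proof (induction \<tau> arbitrary: as F)
  case Iota
  then show ?case by (simp add: apps_def)
next
  case (Arr \<rho> \<sigma>)
  from Arr.prems obtain b bs where b: "as = b # bs" "b \<in> den \<rho>"
    "list_all2 (\<lambda>a \<rho>. a \<in> den \<rho>) bs (args \<sigma>)"
    by (auto simp: list_all2_Cons2)
  show ?case using Arr.IH(2)[OF b(3)] by (simp add: b apps_def app_abstr)
qed

definition pre :: "('f, 'q) automaton \<Rightarrow> 'f letter \<Rightarrow> 'q set list \<Rightarrow> 'q set" where
  "pre \<AA> l As = {q. delta \<AA> q l \<inter> padded (width \<AA>) As \<noteq> {}}"

text \<open>With \<open>l\<close> the letter \<open>\<R>\<close> or \<open>\<beta>\<close>, this is the operation \<open>\<R>(f)\<close> or \<open>\<beta>(f)\<close> on \<open>\<lbrakk>\<tau>\<rbrakk>\<close>.\<close>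

definition lift :: "('f, 'q) automaton \<Rightarrow> 'f letter \<Rightarrow> ty \<Rightarrow> 'q val \<Rightarrow> 'q val" where
  "lift \<AA> l \<tau> f = curried \<tau> (\<lambda>as. pre \<AA> l [base (apps f as)])"

type_synonym ('v, 'q) ctx = "'v var \<rightharpoonup> 'q val"

definition is_context :: "('v, 'q) ctx \<Rightarrow> bool" where
  "is_context \<Gamma> \<longleftrightarrow> finite (dom \<Gamma>) \<and> (\<forall>x a. \<Gamma> x = Some a \<longrightarrow> a \<in> den (snd x))"

definition judgement ::
  "('f, 'q) automaton \<Rightarrow> ('v, 'q) ctx \<Rightarrow> 'q val \<Rightarrow> ('v, 'f) lam \<Rightarrow> ty \<Rightarrow> bool" where
  "judgement \<AA> \<Gamma> a t \<rho> \<longleftrightarrow>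
     is_context \<Gamma> \<and> a \<in> den \<rho> \<and> has_type (arity \<AA>) t \<rho> \<and> fv t \<subseteq> dom \<Gamma>"

inductive derives ::
  "('f, 'q) automaton \<Rightarrow> nat \<Rightarrow> ('v, 'q) ctx \<Rightarrow> 'q val \<Rightarrow> ('v, 'f) lam \<Rightarrow> ty \<Rightarrow> bool"
  for \<AA> where
  zero: "judgement \<AA> \<Gamma> a t \<rho> \<Longrightarrow> derives \<AA> 0 \<Gamma> a t \<rho>"
| var: "judgement \<AA> \<Gamma> a (Var x) \<rho> \<Longrightarrow> \<Gamma> x = Some b \<Longrightarrow> below \<rho> a b \<Longrightarrow>
    derives \<AA> n \<Gamma> a (Var x) \<rho>"
| app: "judgement \<AA> \<Gamma> a (App \<sigma> s t) \<sigma> \<Longrightarrow>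
    f \<in> den (\<rho> \<leadsto> \<sigma>) \<Longrightarrow> u \<in> den \<rho> \<Longrightarrow> below \<sigma> a (lift \<AA> Rep \<sigma> (app f u)) \<Longrightarrow>
    derives \<AA> n \<Gamma> f s (\<rho> \<leadsto> \<sigma>) \<Longrightarrow> derives \<AA> n \<Gamma> u t \<rho> \<Longrightarrow>
    derives \<AA> (Suc n) \<Gamma> a (App \<sigma> s t) \<sigma>"
| lam: "judgement \<AA> \<Gamma> f (Lam x s) (\<rho> \<leadsto> \<sigma>) \<Longrightarrow>
    (\<And>a. a \<in> den \<rho> \<Longrightarrow> \<exists>b\<in>den \<sigma>.
       below \<sigma> (app f a) (lift \<AA> Beta \<sigma> b) \<and> derives \<AA> n (\<Gamma>(x \<mapsto> a)) b s \<sigma>) \<Longrightarrow>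
    derives \<AA> (Suc n) \<Gamma> f (Lam x s) (\<rho> \<leadsto> \<sigma>)"
| const: "judgement \<AA> \<Gamma> f (Const c) \<rho> \<Longrightarrow>
    (\<And>As. length As = arity \<AA> c \<Longrightarrow> base (apps f (map Base As)) \<subseteq> pre \<AA> (Orig c) As) \<Longrightarrow>
    derives \<AA> n \<Gamma> f (Const c) \<rho>"

text \<open>
  \<open>canon \<AA> \<tau> t\<close> is \<open>\<lbrakk>t\<rbrakk>\<^sub>\<infinity>\<close> for closed \<open>t\<close> of type \<open>\<tau>\<close>, and \<open>canon_open \<AA> \<Gamma> \<tau> t\<close> is \<open>\<lbrakk>t\<rbrakk>\<^sub>\<infinity>\<close> relative
  to \<open>\<Gamma>\<close>.
\<close>

lemma size_args: "i < length (args \<tau>) \<Longrightarrow> size (args \<tau> ! i) < size \<tau>"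
proof (induction \<tau> arbitrary: i)
  case Iota
  then show ?case by simp
next
  case (Arr \<rho> \<sigma>)
  then show ?case by (cases i) (auto simp: less_SucI trans_less_add2)
qed

function canon :: "('f, 'q) automaton \<Rightarrow> ty \<Rightarrow> ('v, 'f) lam \<Rightarrow> 'q val" where
  "canon \<AA> \<tau> t = curried \<tau> (\<lambda>as. {q. \<exists>ss.
     length ss = length (args \<tau>) \<and>
     (\<forall>i<length (args \<tau>). closed_of_type (arity \<AA>) (ss ! i) (args \<tau> ! i) \<and>
        below (args \<tau> ! i) (canon \<AA> (args \<tau> ! i) (ss ! i)) (as ! i)) \<and>
     has_run \<AA> q (cn t ss)})"
  by pat_completeness auto
termination
  by (relation "measure (\<lambda>(\<AA>, \<tau>, t). size \<tau>)") (auto simp: size_args)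

declare canon.simps [simp del]

definition canon_open ::
  "('f, 'q) automaton \<Rightarrow> ('v, 'q) ctx \<Rightarrow> ty \<Rightarrow> ('v, 'f) lam \<Rightarrow> 'q val" where
  "canon_open \<AA> \<Gamma> \<tau> t = curried \<tau> (\<lambda>as. {q. \<exists>\<eta> ss.
     dom \<eta> = dom \<Gamma> \<and>
     (\<forall>x\<in>dom \<Gamma>. closed_of_type (arity \<AA>) (the (\<eta> x)) (snd x) \<and>
        below (snd x) (canon \<AA> (snd x) (the (\<eta> x))) (the (\<Gamma> x))) \<and>
     length ss = length (args \<tau>) \<and>
     (\<forall>i<length (args \<tau>). closed_of_type (arity \<AA>) (ss ! i) (args \<tau> ! i) \<and>
        below (args \<tau> ! i) (canon \<AA> (args \<tau> ! i) (ss ! i)) (as ! i)) \<and>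
     has_run \<AA> q (cn (subst \<eta> t) ss)})"

end

(* The canonical denotations are themselves the witnesses required by the rules. Given a substitution
   and arguments together with a run on the continuous normal form of t, one step of that normal
   form is peeled off: below an R node the substituted operand becomes an argument whose
   canonical denotation is bounded through the same substitution, and below a beta node the first
   argument becomes the value of the bound variable in an extended substitution. *)
theory Submission
  imports Defs
begin

section \<open>Substitution of closed terms\<close>

lemma subst_simps [simp]:
  "subst \<eta> (Var x) = (case \<eta> x of None \<Rightarrow> Var x | Some s \<Rightarrow> s)"
  "subst \<eta> (Lam x s) = Lam x (subst (\<eta>(x := None)) s)"
  "subst \<eta> (App \<sigma> r s) = App \<sigma> (subst \<eta> r) (subst \<eta> s)"
  "subst \<eta> (Const f) = Const f"
  by (subst subst.code; simp split: option.split)+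

lemma free_in_simps [simp]:
  "free_in x (Var y) \<longleftrightarrow> x = y"
  "free_in x (Lam y s) \<longleftrightarrow> x \<noteq> y \<and> free_in x s"
  "free_in x (App \<sigma> r s) \<longleftrightarrow> free_in x r \<or> free_in x s"
  "\<not> free_in x (Const f)"
  by (auto elim: free_in.cases intro: free_in.intros)

lemma fv_simps [simp]:
  "fv (Var y) = {y}"
  "fv (Lam y s) = fv s - {y}"
  "fv (App \<sigma> r s) = fv r \<union> fv s"
  "fv (Const f) = {}"
  by (auto simp: fv_def)

text \<open>Passing a binder may expose its variable as free, but the substitution drops that
  variable too, so disjointness persists at every depth.\<close>

lemma subst_fresh: "fv t \<inter> dom \<eta> = {} \<Longrightarrow> subst \<eta> t = t"
proof (coinduction arbitrary: \<eta> t rule: lam.coinduct_strong)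
  case (Eq_lam \<eta> t)
  then show ?case
  proof (cases t)
    case (Var x)
    with Eq_lam have "\<eta> x = None" by auto
    with Var show ?thesis by simp
  next
    case (Lam x s)
    with Eq_lam have "fv s \<inter> dom (\<eta>(x := None)) = {}" by auto
    with Lam show ?thesis by (auto simp del: fun_upd_apply dom_fun_upd)
  next
    case (App \<sigma> r s)
    with Eq_lam have "fv r \<inter> dom \<eta> = {}" "fv s \<inter> dom \<eta> = {}" by auto
    with App show ?thesis by auto
  qed simp
qed

text \<open>The inserted trees are closed, so \<open>\<theta>\<close> cannot act inside them. This
  is why \<open>\<eta>\<close> has priority in \<open>\<theta> ++ \<eta>\<close>.\<close>

lemma subst_subst:
  assumes "\<And>s. s \<in> ran \<eta> \<Longrightarrow> fv s = {}"
  shows "subst \<theta> (subst \<eta> t) = subst (\<theta> ++ \<eta>) t"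
  using assms
proof (coinduction arbitrary: \<theta> \<eta> t rule: lam.coinduct_strong)
  case (Eq_lam \<theta> \<eta> t)
  show ?case
  proof (cases t)
    case (Var x)
    have "subst \<theta> (subst \<eta> t) = subst (\<theta> ++ \<eta>) t"
    proof (cases "\<eta> x")
      case None
      then show ?thesis using Var by (simp add: map_add_def)
    next
      case (Some s)
      then have "fv s = {}" using Eq_lam by (auto intro: ranI)
      then show ?thesis using Var Some by (simp add: subst_fresh)
    qed
    \<comment> \<open>The two sides are equal outright here, and strong coinduction accepts equal
      subtrees as well as related ones.\<close>
    then show ?thesis
      by (metis lam.collapse(1,2,3,4) lam.exhaust_disc)
  next
    case (Lam x s)
    have *: "(\<theta> ++ \<eta>)(x := None) = \<theta>(x := None) ++ \<eta>(x := None)"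
      by (auto simp: map_add_def fun_eq_iff split: option.split)
    have "\<forall>u. u \<in> ran (\<eta>(x := None)) \<longrightarrow> fv u = {}"
      using Eq_lam by (auto simp: ran_def split: if_splits)
    then show ?thesis unfolding Lam by (simp add: *) blast
  next
    case (App \<sigma> r s)
    then show ?thesis using Eq_lam by auto
  qed simp
qed

text \<open>Settles the variable case below, which arises under every rule of \<open>free_in\<close>
  because an inserted tree can have any shape.\<close>

lemma free_in_subst_Var:
  assumes "free_in x (subst \<eta> (Var z))" "\<And>s. s \<in> ran \<eta> \<Longrightarrow> fv s = {}"
  shows "x = z \<and> \<eta> x = None"
proof (cases "\<eta> z")
  case (Some s)
  then have "fv s = {}" by (intro assms(2) ranI)
  then show ?thesis using assms(1) Some by (auto simp: fv_def simp del: split_paired_All)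
qed (use assms(1) in simp)

text \<open>Trees may be infinite, but a free occurrence lies at finite depth, so the induction is
  on the derivation of freeness in \<open>subst \<eta> t\<close>.\<close>

lemma fv_subst:
  assumes "\<And>s. s \<in> ran \<eta> \<Longrightarrow> fv s = {}"
  shows "fv (subst \<eta> t) \<subseteq> fv t - dom \<eta>"
proof
  fix x assume "x \<in> fv (subst \<eta> t)"
  then have "free_in x (subst \<eta> t)" by (simp add: fv_def)
  then have "free_in x t \<and> x \<notin> dom \<eta>" using assms
  proof (induction "subst \<eta> t" arbitrary: \<eta> t rule: free_in.induct)
    case 1
    have "free_in x (subst \<eta> t)" using 1(1) by (metis free_in.intros(1))
    show ?case
    proof (cases t)
      case (Var z)
      with \<open>free_in x (subst \<eta> t)\<close> have "x = z \<and> \<eta> x = None"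
        using 1(2) by (metis free_in_subst_Var)
      then show ?thesis using Var by auto
    qed (use 1 in auto)
  next
    case (2 u y)
    have "free_in x (subst \<eta> t)" using 2(1,3,4) by (metis free_in.intros(2))
    show ?case
    proof (cases t)
      case (Var z)
      with \<open>free_in x (subst \<eta> t)\<close> have "x = z \<and> \<eta> x = None"
        using 2(5) by (metis free_in_subst_Var)
      then show ?thesis using Var by auto
    next
      case (Lam z s)
      have "\<And>v. v \<in> ran (\<eta>(z := None)) \<Longrightarrow> fv v = {}"
        using 2(5) by (auto simp: ran_def split: if_splits)
      then show ?thesis using 2(2)[of "\<eta>(z := None)" s] 2(3,4) Lam by auto
    qed (use 2 in auto)
  next
    case (3 u \<sigma> v)
    have "free_in x (subst \<eta> t)" using 3(1,3) by (metis free_in.intros(3))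
    show ?case
    proof (cases t)
      case (Var z)
      with \<open>free_in x (subst \<eta> t)\<close> have "x = z \<and> \<eta> x = None"
        using 3(4) by (metis free_in_subst_Var)
      then show ?thesis using Var by auto
    qed (use 3 in auto)
  next
    case (4 u \<sigma> v)
    have "free_in x (subst \<eta> t)" using 4(1,3) by (metis free_in.intros(4))
    show ?case
    proof (cases t)
      case (Var z)
      with \<open>free_in x (subst \<eta> t)\<close> have "x = z \<and> \<eta> x = None"
        using 4(4) by (metis free_in_subst_Var)
      then show ?thesis using Var by auto
    qed (use 4 in auto)
  qed
  then show "x \<in> fv t - dom \<eta>" by (simp add: fv_def)
qed

lemma has_type_subst:
  assumes "has_type ar t \<rho>" "\<And>x s. \<eta> x = Some s \<Longrightarrow> has_type ar s (snd x)"
  shows "has_type ar (subst \<eta> t) \<rho>"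
  using assms
proof (coinduction arbitrary: \<eta> t \<rho> rule: has_type.coinduct)
  case (has_type \<eta> t \<rho>)
  from has_type(1) show ?case
  proof (cases rule: has_type.cases)
    case (1 x)
    show ?thesis
    proof (cases "\<eta> x")
      case None
      then show ?thesis using 1 by simp
    next
      case (Some s)
      \<comment> \<open>The tree is now the inserted \<open>s\<close>, so the rule that types
        \<open>s\<close> supplies the matching case.\<close>
      then have "has_type ar (subst \<eta> t) \<rho>" using 1 Some has_type(2)[rule_format, OF Some] by simp
      then show ?thesis by (cases rule: has_type.cases) auto
    qed
  next
    case (2 s \<sigma> x)
    have "\<forall>y u. (\<eta>(x := None)) y = Some u \<longrightarrow> has_type ar u (snd y)"
      using has_type(2) by simp
    then show ?thesis using 2 by (auto simp del: split_paired_All split_paired_Ex fun_upd_apply)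
  next
    case 3
    then show ?thesis using has_type(2) by auto
  qed simp
qed

section \<open>Canonical denotations\<close>

text \<open>The condition on substitutions inside \<open>canon_open\<close>, phrased with
  \<open>Some\<close> instead of \<open>the\<close> to keep undefined values out of later
  arguments.\<close>

definition realizes_ctx ::
  "('f, 'q) automaton \<Rightarrow> ('v, 'q) ctx \<Rightarrow> ('v var \<rightharpoonup> ('v, 'f) lam) \<Rightarrow> bool" where
  "realizes_ctx \<AA> \<Gamma> \<eta> \<longleftrightarrow> dom \<eta> = dom \<Gamma> \<and>
     (\<forall>x s a. \<eta> x = Some s \<longrightarrow> \<Gamma> x = Some a \<longrightarrow>
        closed_of_type (arity \<AA>) s (snd x) \<and> below (snd x) (canon \<AA> (snd x) s) a)"

text \<open>The condition on arguments common to \<open>canon\<close> and \<open>canon_open\<close>.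
  The type list is a parameter so that arguments can be peeled off one at a time.\<close>

definition realizes_args ::
  "('f, 'q) automaton \<Rightarrow> ty list \<Rightarrow> 'q val list \<Rightarrow> ('v, 'f) lam list \<Rightarrow> bool" where
  "realizes_args \<AA> \<rho>s as ss \<longleftrightarrow> length ss = length \<rho>s \<and>
     (\<forall>i<length \<rho>s. closed_of_type (arity \<AA>) (ss ! i) (\<rho>s ! i) \<and>
        below (\<rho>s ! i) (canon \<AA> (\<rho>s ! i) (ss ! i)) (as ! i))"

lemma realizes_args_Nil [simp]: "realizes_args \<AA> [] as ss \<longleftrightarrow> ss = []"
  by (simp add: realizes_args_def)

lemma realizes_args_Cons [simp]:
  "realizes_args \<AA> (\<rho> # \<rho>s) (a # as) ss \<longleftrightarrow>
     (\<exists>s ss'. ss = s # ss' \<and> closed_of_type (arity \<AA>) s \<rho> \<and> below \<rho> (canon \<AA> \<rho> s) a \<and>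
        realizes_args \<AA> \<rho>s as ss')"
  by (cases ss) (auto simp: realizes_args_def All_less_Suc2)

lemma realizes_ctx_upd:
  assumes "realizes_ctx \<AA> \<Gamma> \<eta>" "closed_of_type (arity \<AA>) s (snd x)"
    "below (snd x) (canon \<AA> (snd x) s) a"
  shows "realizes_ctx \<AA> (\<Gamma>(x \<mapsto> a)) (\<eta>(x \<mapsto> s))"
  using assms by (auto simp: realizes_ctx_def)

lemma realizes_ctx_SomeD:
  assumes "realizes_ctx \<AA> \<Gamma> \<eta>" "\<eta> x = Some s"
  shows "closed_of_type (arity \<AA>) s (snd x)"
proof -
  obtain a where "\<Gamma> x = Some a" using assms by (metis domD domI realizes_ctx_def)
  then show ?thesis using assms unfolding realizes_ctx_def by blast
qed

lemma realizes_ctx_ran: "realizes_ctx \<AA> \<Gamma> \<eta> \<Longrightarrow> s \<in> ran \<eta> \<Longrightarrow> fv s = {}"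
  by (auto simp: ran_def closed_of_type_def dest: realizes_ctx_SomeD)

text \<open>A realizing substitution covers all of \<open>dom \<Gamma>\<close> by closed trees, so
  nothing remains free. This admits a substituted operand as an argument of
  \<open>cn\<close>.\<close>

lemma closed_of_type_subst:
  assumes \<eta>: "realizes_ctx \<AA> \<Gamma> \<eta>" and "has_type (arity \<AA>) t \<rho>" "fv t \<subseteq> dom \<Gamma>"
  shows "closed_of_type (arity \<AA>) (subst \<eta> t) \<rho>"
proof -
  have "fv (subst \<eta> t) \<subseteq> fv t - dom \<eta>"
    by (rule fv_subst) (rule realizes_ctx_ran[OF \<eta>])
  moreover have "dom \<eta> = dom \<Gamma>" using \<eta> by (simp add: realizes_ctx_def)
  moreover have "has_type (arity \<AA>) (subst \<eta> t) \<rho>"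
    using assms(2) by (rule has_type_subst) (use realizes_ctx_SomeD[OF \<eta>] in \<open>simp add: closed_of_type_def\<close>)
  ultimately show ?thesis using assms(3) unfolding closed_of_type_def by blast
qed

section \<open>Denotations on full argument lists\<close>

abbreviation dens :: "'q val list \<Rightarrow> ty list \<Rightarrow> bool" where
  "dens \<equiv> list_all2 (\<lambda>a \<rho>. a \<in> den \<rho>)"

lemma apps_Cons [simp]: "apps f (a # as) = apps (app f a) as"
  by (simp add: apps_def)

text \<open>Reduces the inequalities of the proof rules to inclusions of sets of states, where runs
  can be compared directly.\<close>

lemma below_iff_apps:
  "below \<tau> f g \<longleftrightarrow> (\<forall>as. dens as (args \<tau>) \<longrightarrow> base (apps f as) \<subseteq> base (apps g as))"
proof (induction \<tau> arbitrary: f g)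
  case Iota
  show ?case by (simp add: apps_def)
next
  case (Arr \<rho> \<sigma>)
  show ?case
    by (simp add: Arr.IH(2) list_all2_Cons2) (metis apps_Cons)
qed

lemma base_apps_canon:
  fixes \<AA> :: "('f, 'q::finite) automaton"
  assumes "dens as (args \<tau>)"
  shows "base (apps (canon \<AA> \<tau> t) as) = {q. \<exists>ss. realizes_args \<AA> (args \<tau>) as ss \<and> has_run \<AA> q (cn t ss)}"
  by (subst canon.simps) (simp add: apps_curried[OF assms] realizes_args_def conj_assoc)

lemma base_apps_canon_open:
  fixes \<AA> :: "('f, 'q::finite) automaton"
  assumes "dens as (args \<tau>)"
  shows "base (apps (canon_open \<AA> \<Gamma> \<tau> t) as) =
    {q. \<exists>\<eta> ss. realizes_ctx \<AA> \<Gamma> \<eta> \<and> realizes_args \<AA> (args \<tau>) as ss \<and> has_run \<AA> q (cn (subst \<eta> t) ss)}"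
proof -
  have "realizes_ctx \<AA> \<Gamma> \<eta> \<longleftrightarrow> dom \<eta> = dom \<Gamma> \<and>
     (\<forall>x\<in>dom \<Gamma>. closed_of_type (arity \<AA>) (the (\<eta> x)) (snd x) \<and>
        below (snd x) (canon \<AA> (snd x) (the (\<eta> x))) (the (\<Gamma> x)))" for \<eta>
    unfolding realizes_ctx_def
    \<comment> \<open>Under the shared equation of domains, every \<open>the\<close> is applied to a
      \<open>Some\<close>.\<close>
    by (rule conj_cong[OF refl], standard) (force simp: domIff, metis domI option.sel)
  then show ?thesis
    by (simp add: canon_open_def apps_curried[OF assms] realizes_args_def conj_assoc)
qed

lemma base_apps_lift:
  fixes f :: "'q::finite val"
  assumes "dens as (args \<tau>)"
  shows "base (apps (lift \<AA> l \<tau> f) as) = pre \<AA> l [base (apps f as)]"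
  unfolding lift_def by (rule apps_curried[OF assms])

lemma canon_open_in_den: "canon_open \<AA> \<Gamma> \<tau> t \<in> (den \<tau> :: 'q::finite val set)"
  unfolding canon_open_def by (rule curried_in_den)

lemma canon_below_canon_open:
  fixes \<AA> :: "('f, 'q::finite) automaton"
  assumes "realizes_ctx \<AA> \<Gamma> \<eta>"
  shows "below \<tau> (canon \<AA> \<tau> (subst \<eta> t)) (canon_open \<AA> \<Gamma> \<tau> t)"
  using assms by (auto simp: below_iff_apps base_apps_canon base_apps_canon_open)

section \<open>Peeling the root letter off a run\<close>

lemma has_run_Node:
  assumes "has_run \<AA> q (Node l Ts)" "length Ts = letter_arity (arity \<AA>) l"
    and "length As = length Ts"
    and "\<And>i q'. i < length Ts \<Longrightarrow> has_run \<AA> q' (Ts ! i) \<Longrightarrow> q' \<in> As ! i"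
  shows "q \<in> pre \<AA> l As"
proof -
  from assms(1) obtain r where r: "r [] = q"
    "\<And>p U. subtree_at p (Node l Ts) = Some U \<Longrightarrow>
      map (\<lambda>i. Some (r (p @ [i]))) [0..<letter_arity (arity \<AA>) (root U)]
        @ replicate (width \<AA> - letter_arity (arity \<AA>) (root U)) None \<in> delta \<AA> (r p) (root U)"
    unfolding has_run_def is_run_def Let_def by blast
  have "r [i] \<in> As ! i" if i: "i < length Ts" for i
  proof (rule assms(4)[OF i])
    \<comment> \<open>Restricting a run to the \<open>i\<close>-th subtree amounts to prefixing
      every path with \<open>i\<close>.\<close>
    have "is_run \<AA> (r [i]) (Ts ! i) (\<lambda>p. r (i # p))"
      unfolding is_run_def Let_def using r(2)[of "i # p" for p] i by simp
    then show "has_run \<AA> (r [i]) (Ts ! i)" unfolding has_run_def by blast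
  qed
  then have "list_all2 (\<in>) (map (\<lambda>i. r [i]) [0..<length Ts]) As"
    using assms(3) by (simp add: list_all2_conv_all_nth)
  \<comment> \<open>The transition at the root; the equations of lengths make its padding agree with
    that of \<open>padded\<close>.\<close>
  moreover have "map Some (map (\<lambda>i. r [i]) [0..<length Ts]) @ replicate (width \<AA> - length As) None
      \<in> delta \<AA> q l"
    using r(2)[of "[]"] r(1) assms(2,3) by (simp add: comp_def)
  ultimately show ?thesis unfolding pre_def padded_def by blast
qed

lemma has_run_unary:
  assumes "has_run \<AA> q (Node l [T])" "letter_arity (arity \<AA>) l = 1"
    and "\<And>q'. has_run \<AA> q' T \<Longrightarrow> q' \<in> A"
  shows "q \<in> pre \<AA> l [A]"
  using assms by (intro has_run_Node[OF assms(1)]) auto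

section \<open>The rules hold for canonical denotations\<close>

text \<open>A run on the substituted variable is a run on the tree that \<open>\<eta>\<close> puts
  there, whose canonical value is bounded by \<open>a\<close>.\<close>

lemma canon_open_Var:
  fixes \<AA> :: "('f, 'q::finite) automaton"
  assumes "\<Gamma> x = Some a"
  shows "below (snd x) (canon_open \<AA> \<Gamma> (snd x) (Var x :: ('v, 'f) lam)) a"
  unfolding below_iff_apps
proof (intro allI impI subsetI)
  fix as q assume as: "dens as (args (snd x))"
    and "q \<in> base (apps (canon_open \<AA> \<Gamma> (snd x) (Var x :: ('v, 'f) lam)) as)"
  then obtain \<eta> and ss :: "('v, 'f) lam list" where \<eta>: "realizes_ctx \<AA> \<Gamma> \<eta>"
    and ss: "realizes_args \<AA> (args (snd x)) as ss" "has_run \<AA> q (cn (subst \<eta> (Var x)) ss)"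
    by (auto simp: base_apps_canon_open)
  obtain s where s: "\<eta> x = Some s" using \<eta> assms by (force simp: realizes_ctx_def)
  then have "below (snd x) (canon \<AA> (snd x) s) a"
    using \<eta> assms unfolding realizes_ctx_def by blast
  moreover have "q \<in> base (apps (canon \<AA> (snd x) s) as)"
    using ss s by (auto simp: base_apps_canon[OF as])
  ultimately show "q \<in> base (apps a as)" using as by (auto simp: below_iff_apps)
qed

lemma canon_open_App:
  fixes \<AA> :: "('f, 'q::finite) automaton"
  assumes "has_type (arity \<AA>) t \<rho>" "fv t \<subseteq> dom \<Gamma>"
  shows "below \<sigma> (canon_open \<AA> \<Gamma> \<sigma> (App \<sigma> s t))
    (lift \<AA> Rep \<sigma> (app (canon_open \<AA> \<Gamma> (\<rho> \<leadsto> \<sigma>) s) (canon_open \<AA> \<Gamma> \<rho> t)))"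
  unfolding below_iff_apps
proof (intro allI impI subsetI)
  fix as q assume as: "dens as (args \<sigma>)"
    and "q \<in> base (apps (canon_open \<AA> \<Gamma> \<sigma> (App \<sigma> s t)) as)"
  then obtain \<eta> ss where \<eta>: "realizes_ctx \<AA> \<Gamma> \<eta>"
    and ss: "realizes_args \<AA> (args \<sigma>) as ss"
    and run: "has_run \<AA> q (Node Rep [cn (subst \<eta> s) (subst \<eta> t # ss)])"
    by (auto simp: base_apps_canon_open cn_simps)
  let ?u = "canon_open \<AA> \<Gamma> \<rho> t"
  have u_as: "dens (?u # as) (args (\<rho> \<leadsto> \<sigma>))"
    using as by (simp add: canon_open_in_den)
  have args: "realizes_args \<AA> (args (\<rho> \<leadsto> \<sigma>)) (?u # as) (subst \<eta> t # ss)"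
    \<comment> \<open>The substituted operand joins the arguments: it is closed, and the same
      \<open>\<eta>\<close> bounds its value by \<open>?u\<close>.\<close>
    using ss by (simp add: closed_of_type_subst[OF \<eta> assms] canon_below_canon_open[OF \<eta>])
  \<comment> \<open>Any run below the root witnesses membership in the value of \<open>s\<close>,
    with \<open>\<eta>\<close> and the extended argument list.\<close>
  have "q \<in> pre \<AA> Rep [base (apps (canon_open \<AA> \<Gamma> (\<rho> \<leadsto> \<sigma>) s) (?u # as))]"
    using run by (rule has_run_unary) (use \<eta> args in \<open>auto simp only: base_apps_canon_open[OF u_as] letter_arity.simps\<close>)
  then show "q \<in> base (apps (lift \<AA> Rep \<sigma> (app (canon_open \<AA> \<Gamma> (\<rho> \<leadsto> \<sigma>) s) ?u)) as)"
    by (simp add: base_apps_lift[OF as])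
qed

lemma canon_open_Lam:
  fixes \<AA> :: "('f, 'q::finite) automaton"
  assumes a: "a \<in> den (snd x)"
  shows "below \<sigma> (app (canon_open \<AA> \<Gamma> (snd x \<leadsto> \<sigma>) (Lam x s)) a)
    (lift \<AA> Beta \<sigma> (canon_open \<AA> (\<Gamma>(x \<mapsto> a)) \<sigma> s))"
  unfolding below_iff_apps
proof (intro allI impI subsetI)
  fix as q assume as: "dens as (args \<sigma>)"
    and q: "q \<in> base (apps (app (canon_open \<AA> \<Gamma> (snd x \<leadsto> \<sigma>) (Lam x s)) a) as)"
  have "dens (a # as) (args (snd x \<leadsto> \<sigma>))" using a as by simp
  from base_apps_canon_open[OF this, of \<AA> \<Gamma> "Lam x s"] q
  obtain \<eta> u ss where \<eta>: "realizes_ctx \<AA> \<Gamma> \<eta>"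
    and u: "closed_of_type (arity \<AA>) u (snd x)" "below (snd x) (canon \<AA> (snd x) u) a"
    and ss: "realizes_args \<AA> (args \<sigma>) as ss"
    and run: "has_run \<AA> q (Node Beta [cn (subst [x \<mapsto> u] (subst (\<eta>(x := None)) s)) ss])"
    by (auto simp: cn_simps)
  have "fv v = {}" if "v \<in> ran (\<eta>(x := None))" for v
    using that realizes_ctx_ran[OF \<eta>] by (auto simp: ran_def split: if_splits)
  \<comment> \<open>The binder hides any old value at \<open>x\<close> and the beta step inserts
    \<open>u\<close>; together they form one substitution realizing the extended context.\<close>
  then have "subst [x \<mapsto> u] (subst (\<eta>(x := None)) s) = subst ([x \<mapsto> u] ++ \<eta>(x := None)) s"
    by (rule subst_subst)
  also have "[x \<mapsto> u] ++ \<eta>(x := None) = \<eta>(x \<mapsto> u)"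
    by (auto simp: map_add_def fun_eq_iff split: option.split)
  finally have comp: "subst [x \<mapsto> u] (subst (\<eta>(x := None)) s) = subst (\<eta>(x \<mapsto> u)) s" .
  have "q \<in> pre \<AA> Beta [base (apps (canon_open \<AA> (\<Gamma>(x \<mapsto> a)) \<sigma> s) as)]"
    using run unfolding comp
    by (rule has_run_unary)
      (use realizes_ctx_upd[OF \<eta> u] ss in \<open>auto simp only: base_apps_canon_open[OF as] letter_arity.simps\<close>)
  then show "q \<in> base (apps (lift \<AA> Beta \<sigma> (canon_open \<AA> (\<Gamma>(x \<mapsto> a)) \<sigma> s)) as)"
    by (simp add: base_apps_lift[OF as])
qed

lemma args_const_type: "args (const_type k) = replicate k Iota"
  by (induction k) auto

text \<open>The children of the root are the normal forms of the arguments, so a run assigns the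
  \<open>i\<close>-th child a state from the value of the \<open>i\<close>-th argument, which lies
  in \<open>As ! i\<close>.\<close>

lemma canon_open_Const:
  fixes \<AA> :: "('f, 'q::finite) automaton" and c :: 'f
  assumes len: "length As = arity \<AA> c"
  shows "base (apps (canon_open \<AA> \<Gamma> (const_type (arity \<AA> c)) (Const c :: ('v, 'f) lam)) (map Base As))
    \<subseteq> pre \<AA> (Orig c) As"
proof
  let ?\<tau> = "const_type (arity \<AA> c)"
  have dens: "dens (map Base As) (args ?\<tau>)"
    using len by (simp add: args_const_type list_all2_conv_all_nth)
  fix q assume "q \<in> base (apps (canon_open \<AA> \<Gamma> ?\<tau> (Const c :: ('v, 'f) lam)) (map Base As))"
  then obtain ss :: "('v, 'f) lam list" where ss: "realizes_args \<AA> (args ?\<tau>) (map Base As) ss"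
    and run: "has_run \<AA> q (Node (Orig c) (map (\<lambda>u. cn u []) ss))"
    by (auto simp: base_apps_canon_open[OF dens] cn_simps)
  have len_ss: "length ss = arity \<AA> c"
    using ss by (simp add: realizes_args_def args_const_type)
  show "q \<in> pre \<AA> (Orig c) As"
  proof (rule has_run_Node[OF run])
    fix i q' assume "i < length (map (\<lambda>u. cn u []) ss)"
      and "has_run \<AA> q' (map (\<lambda>u. cn u []) ss ! i)"
    then have i: "i < arity \<AA> c" and q': "has_run \<AA> q' (cn (ss ! i) [])"
      using len_ss by auto
    have "base (canon \<AA> Iota (ss ! i)) \<subseteq> As ! i"
      using ss i len by (simp add: realizes_args_def args_const_type)
    moreover have "q' \<in> base (canon \<AA> Iota (ss ! i))"
      \<comment> \<open>At type \<open>Iota\<close> the canonical value is exactly the set of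
        starting states of runs.\<close>
      using base_apps_canon[of "[]" Iota \<AA> "ss ! i"] q' by (simp add: apps_def)
    ultimately show "q' \<in> As ! i" by blast
  qed (simp_all add: len len_ss)
qed

theorem theorem8p9:
  fixes \<AA> :: "('f, 'q::finite) automaton"
    and \<Gamma> :: "('v, 'q) ctx"
    and t :: "('v, 'f) lam"
    and \<rho> :: ty
    and n :: nat
  assumes "trivial_automaton \<AA>"
    and "is_context \<Gamma>"
    and "has_type (arity \<AA>) t \<rho>"
    and "fv t \<subseteq> dom \<Gamma>"
  shows "derives \<AA> n \<Gamma> (canon_open \<AA> \<Gamma> \<rho> t) t \<rho>"
  using assms(2-4)
\<comment> \<open>The context must vary because abstraction extends it; the tree and its type vary
  because the rules pass to subtrees.\<close>
proof (induction n arbitrary: \<Gamma> t \<rho>)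
  case 0
  then show ?case by (intro derives.zero) (simp add: judgement_def canon_open_in_den)
next
  case (Suc n)
  have j: "judgement \<AA> \<Gamma> (canon_open \<AA> \<Gamma> \<rho> t) t \<rho>"
    using Suc.prems by (simp add: judgement_def canon_open_in_den)
  \<comment> \<open>Each shape of tree has exactly one rule at level \<open>Suc n\<close>, and the
    last typing rule determines the shape.\<close>
  from Suc.prems(2) show ?case
  proof (cases rule: has_type.cases)
    case (1 x)
    obtain a where a: "\<Gamma> x = Some a" using Suc.prems(3) 1 by auto
    from j show ?thesis unfolding 1
      by (rule derives.var[where b = a]) (fact a, rule canon_open_Var, fact a)
  next
    case (2 s \<sigma> x)
    have "is_context (\<Gamma>(x \<mapsto> a))" if "a \<in> den (snd x)" for a
      using that Suc.prems(1) unfolding is_context_def by (auto simp del: split_paired_All)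
    then have "derives \<AA> n (\<Gamma>(x \<mapsto> a)) (canon_open \<AA> (\<Gamma>(x \<mapsto> a)) \<sigma> s) s \<sigma>" if "a \<in> den (snd x)" for a
      using that Suc.prems 2 by (intro Suc.IH) (auto simp del: fun_upd_apply)
    \<comment> \<open>For each \<open>a\<close>, the witness \<open>b\<close> is the canonical value
      of the body in \<open>\<Gamma>(x \<mapsto> a)\<close>.\<close>
    with j show ?thesis unfolding 2
      by (intro derives.lam) (use canon_open_in_den canon_open_Lam in blast)+
  next
    case (3 s \<rho>' t')
    have "derives \<AA> n \<Gamma> (canon_open \<AA> \<Gamma> (\<rho>' \<leadsto> \<rho>) s) s (\<rho>' \<leadsto> \<rho>)"
      "derives \<AA> n \<Gamma> (canon_open \<AA> \<Gamma> \<rho>' t') t' \<rho>'"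
      using Suc.prems 3 by (auto intro!: Suc.IH)
    moreover have "fv t' \<subseteq> dom \<Gamma>" using Suc.prems(3) 3 by simp
    \<comment> \<open>The witnesses \<open>f\<close> and \<open>u\<close> are the canonical values
      of operator and operand in the same context.\<close>
    ultimately show ?thesis using j 3(3) unfolding 3(1)
      by (intro derives.app[OF _ canon_open_in_den canon_open_in_den canon_open_App])
  next
    case (4 c)
    from j show ?thesis unfolding 4 by (intro derives.const canon_open_Const)
  qed
qed

end
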